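(* Let $X$ be a metric space, let $\mu$ be a measure over $X$, let $\alpha>0$ and fix $A\subset X$. If $\mathcal F_{\mu,\zeta_\alpha}$ covers $A$ finely, then $\mathfrak d^\alpha(\mu,\cdot):A\to[0,+\infty]$ is Borel with respect to the subspace topology of $A$.
   Context: A "measure over $X$" is an outer measure defined on all subsets of $X$. $\mathcal F$ is the family of all closed subsets of $X$, $c_\alpha>0$ is a fixed constant, and $\zeta_\alpha:\mathcal F\to[0,+\infty]$ is $\zeta_\alpha(S)=c_\alpha\operatorname{diam}(S)^\alpha$ (with $\operatorname{diam}(\emptyset)=0$). $\mathcal F_{\mu,\zeta_\alpha}=\mathcal F\setminus\{S\in\mathcal F:\ \zeta_\alpha(S)=\mu(S)=0\ \text{or}\ \mu(S)=\zeta_\alpha(S)=+\infty\}$. A family $\mathcal G\subset\mathcal P(X)$ covers $A$ finely if for every $a\in A$ and $\epsilon>0$ there is $S\in\mathcal G$ with $a\in S$ and $\operatorname{diam}(S)<\epsilon$. The quotient function $Q_{\mu,\zeta_\alpha}:\mathcal F_{\mu,\zeta_\alpha}\to[0,+\infty]$ is $Q_{\mu,\zeta_\alpha}(S)=+\infty$ if $\zeta_\alpha(S)=0$, $Q_{\mu,\zeta_\alpha}(S)=\mu(S)/\zeta_\alpha(S)$ if $0<\zeta_\alpha(S)<+\infty$, and $Q_{\mu,\zeta_\alpha}(S)=0$ if $\zeta_\alpha(S)=+\infty$. For $x\in A$ the Federer density is $$\mathfrak d^\alpha(\mu,x)=\inf_{\epsilon>0}\sup\{Q_{\mu,\zeta_\alpha}(S):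 S\in\mathcal F_{\mu,\zeta_\alpha},\ x\in S,\ \operatorname{diam}(S)<\epsilon\}.$$ *)

theory Defs
  imports "HOL-Analysis.Analysis"
begin

text \<open>
  The library's \<^const>\<open>diameter\<close> is real-valued and meaningless on unbounded sets, so the
  diameter is taken in \<open>[0, \<infinity>]\<close>. Suprema are those of \<^typ>\<open>ennreal\<close>, hence
  \<open>ediam {} = 0\<close>.
\<close>

definition ediam :: "'a::metric_space set \<Rightarrow> ennreal" where
  "ediam S = (SUP x\<in>S. SUP y\<in>S. ennreal (dist x y))"

lemma ediam_bounded: "bounded S \<Longrightarrow> ediam S = ennreal (diameter S)"
proof (rule antisym)
  assume S: "bounded S"
  then show "ediam S \<le> ennreal (diameter S)"
    unfolding ediam_def by (intro SUP_least ennreal_leI diameter_bounded_bound)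
  show "ennreal (diameter S) \<le> ediam S"
  proof (cases "ediam S")
    case (real r)
    have "dist x y \<le> r" if "x \<in> S" "y \<in> S" for x y
    proof -
      have "ennreal (dist x y) \<le> (SUP y\<in>S. ennreal (dist x y))"
        using that by (intro SUP_upper)
      also have "\<dots> \<le> ediam S"
        unfolding ediam_def using that by (intro SUP_upper)
      finally show ?thesis
        using real by simp
    qed
    then have "diameter S \<le> r"
      using real unfolding diameter_def by (auto intro!: cSUP_least)
    then show ?thesis
      using real by (simp add: ennreal_leI)
  qed auto
qed

lemma ediam_unbounded: "\<not> bounded S \<Longrightarrow> ediam S = \<infinity>"
proof (rule ccontr)
  assume S: "\<not> bounded S" and "ediam S \<noteq> \<infinity>"
  then obtain r where r: "0 \<le> r" "ediam S = ennreal r"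
    by (cases "ediam S") auto
  have "dist x y \<le> r" if "x \<in> S" "y \<in> S" for x y
  proof -
    have "ennreal (dist x y) \<le> (SUP y\<in>S. ennreal (dist x y))"
      using that by (intro SUP_upper)
    also have "\<dots> \<le> ediam S"
      unfolding ediam_def using that by (intro SUP_upper)
    finally show ?thesis
      using r by simp
  qed
  then have "bounded S"
    using bounded_two_points by blast
  with S show False by simp
qed

text \<open>Real powers on \<open>[0, \<infinity>]\<close>, for exponents \<open>a > 0\<close> only: \<open>0 powr a = 0\<close> and
  \<open>\<infinity> powr a = \<infinity>\<close>.\<close>

definition ennpowr :: "ennreal \<Rightarrow> real \<Rightarrow> ennreal" where
  "ennpowr t a = (if t = \<infinity> then \<infinity> else ennreal (enn2real t powr a))"

definition zeta :: "real \<Rightarrow> real \<Rightarrow> 'a::metric_space set \<Rightarrow> ennreal" where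
  "zeta c \<alpha> S = ennreal c * ennpowr (ediam S) \<alpha>"

definition F_family ::
  "('a::metric_space set \<Rightarrow> ennreal) \<Rightarrow> ('a set \<Rightarrow> ennreal) \<Rightarrow> 'a set set" where
  "F_family \<mu> \<zeta> =
     {S. closed S} - {S. closed S \<and> (\<zeta> S = 0 \<and> \<mu> S = 0 \<or> \<mu> S = \<infinity> \<and> \<zeta> S = \<infinity>)}"

definition covers_finely :: "'a::metric_space set set \<Rightarrow> 'a set \<Rightarrow> bool" where
  "covers_finely \<G> A \<longleftrightarrow>
     (\<forall>a\<in>A. \<forall>\<epsilon>::real. \<epsilon> > 0 \<longrightarrow> (\<exists>S\<in>\<G>. a \<in> S \<and> ediam S < ennreal \<epsilon>))"

text \<open>Only the values on \<^term>\<open>F_family \<mu> \<zeta>\<close> are meaningful.\<close>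

definition Q_quot ::
  "('a::metric_space set \<Rightarrow> ennreal) \<Rightarrow> ('a set \<Rightarrow> ennreal) \<Rightarrow> 'a set \<Rightarrow> ennreal" where
  "Q_quot \<mu> \<zeta> S =
     (if \<zeta> S = 0 then \<infinity> else if \<zeta> S < \<infinity> then \<mu> S / \<zeta> S else 0)"

definition federer_density ::
  "real \<Rightarrow> real \<Rightarrow> ('a::metric_space set \<Rightarrow> ennreal) \<Rightarrow> 'a \<Rightarrow> ennreal" where
  "federer_density c \<alpha> \<mu> x =
     (INF \<epsilon>\<in>{0::real<..}.
        SUP S\<in>{S \<in> F_family \<mu> (zeta c \<alpha>). x \<in> S \<and> ediam S < ennreal \<epsilon>}.
          Q_quot \<mu> (zeta c \<alpha>) S)"

text \<open>The \<open>\<sigma>\<close>-algebra of \<^term>\<open>restrict_space borel A\<close> is the Borel \<open>\<sigma>\<close>-algebra of the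
  subspace topology of \<open>A\<close>.\<close>

lemma sets_restrict_space_borel:
  "sets (restrict_space borel A) = sigma_sets A {U. openin (top_of_set A) U}"
proof -
  have "sets (restrict_space borel A) = {(\<lambda>x. x) -` B \<inter> A |B. B \<in> sigma_sets UNIV {S. open S}}"
    by (auto simp: sets_restrict_space sets_borel)
  also have "\<dots> = sigma_sets A {(\<lambda>x. x) -` B \<inter> A |B. B \<in> {S. open S}}"
    by (rule sigma_sets_vimage_commute) auto
  also have "{(\<lambda>x. x) -` B \<inter> A |B. B \<in> {S. open S}} = {U. openin (top_of_set A) U}"
    by (auto simp: openin_open)
  finally show ?thesis .
qed

text \<open>The library's \<^const>\<open>countably_subadditive\<close> speaks of disjoint families only; on all
  subsets, an outer measure is countably subadditive in the usual sense.\<close>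

lemma outer_measure_space_subadditive:
  fixes B :: "nat \<Rightarrow> 'a set"
  assumes "outer_measure_space (Pow UNIV) f"
  shows "f (\<Union>i. B i) \<le> (\<Sum>i. f (B i))"
proof -
  have "f (\<Union>i. B i) = f (\<Union>i. disjointed B i)"
    by (simp add: UN_disjointed_eq)
  also have "\<dots> \<le> (\<Sum>i. f (disjointed B i))"
    using assms disjoint_family_disjointed[of B]
    by (simp add: outer_measure_space_def countably_subadditive_def)
  also have "\<dots> \<le> (\<Sum>i. f (B i))"
    using assms disjointed_subset[of B]
    by (intro suminf_le) (auto simp: outer_measure_space_def increasing_def)
  finally show ?thesis .
qed

end

theory Submission
  imports Defs
begin

text \<open>
  If \<open>x \<in> S\<close> and \<open>\<delta> > 0\<close>, then \<open>S \<union> cball x \<delta>\<close> is a closed neighbourhood of \<open>x\<close> whose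
  \<open>\<mu>\<close>-value is at least that of \<open>S\<close> and whose diameter exceeds that of \<open>S\<close> by at most \<open>2\<delta>\<close>.
  As \<open>t < Q S\<close> amounts to the strict inequality \<open>t * \<zeta> S < \<mu> S\<close> (also when \<open>\<zeta> S = 0\<close>), it
  survives this enlargement for small \<open>\<delta>\<close>. Hence the supremum in the density at a fixed
  scale \<open>\<epsilon>\<close> is lower semicontinuous in \<open>x\<close>, and the density is the infimum of countably
  many of these suprema.
\<close>

lemma dist_le_ediam:
  assumes "x \<in> S" "y \<in> S"
  shows "ennreal (dist x y) \<le> ediam S"
  unfolding ediam_def using assms by (intro SUP_upper2[of x] SUP_upper2[of y]) auto

text \<open>Two points that do not both lie in \<open>S\<close> include one of
  \<open>cball x \<delta>\<close>, within \<delta> of \<open>x\<close>; the other is within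
  \<open>d + \<delta>\<close> of \<open>x\<close>, as \<open>x\<close> itself belongs to
  \<open>S\<close>.\<close>

lemma ediam_Un_cball_le:
  assumes "x \<in> S" "0 \<le> d" "0 \<le> \<delta>" "ediam S \<le> ennreal d"
  shows "ediam (S \<union> cball x \<delta>) \<le> ennreal (d + 2 * \<delta>)"
proof -
  have dS: "dist y z \<le> d" if "y \<in> S" "z \<in> S" for y z
    using dist_le_ediam[OF that] assms by (metis ennreal_le_iff order_trans)
  have "dist y z \<le> d + 2 * \<delta>" if "y \<in> S \<union> cball x \<delta>" "z \<in> S \<union> cball x \<delta>" for y z
  proof (cases "y \<in> S \<and> z \<in> S")
    case True
    then show ?thesis using dS[of y z] assms by simp
  next
    case False
    have "dist y x \<le> d + \<delta> \<and> dist z x \<le> d + \<delta>"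
      using that assms dS[of y x] dS[of z x] by (auto simp: dist_commute)
    moreover have "dist y x \<le> \<delta> \<or> dist z x \<le> \<delta>"
      using that False by (auto simp: dist_commute)
    ultimately show ?thesis
      using dist_triangle2[of y z x] by linarith
  qed
  then show ?thesis
    unfolding ediam_def by (intro SUP_least ennreal_leI)
qed

lemma zeta_le:
  assumes "0 \<le> c" "0 \<le> \<alpha>" "0 \<le> d" "ediam S \<le> ennreal d"
  shows "zeta c \<alpha> S \<le> ennreal (c * d powr \<alpha>)"
proof -
  obtain e where e: "0 \<le> e" "e \<le> d" "ediam S = ennreal e"
    using assms by (cases "ediam S") (auto simp: top_unique)
  have "zeta c \<alpha> S = ennreal (c * e powr \<alpha>)"
    using e assms by (simp add: zeta_def ennpowr_def ennreal_mult)
  also have "\<dots> \<le> ennreal (c * d powr \<alpha>)"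
    using e assms by (intro ennreal_leI mult_left_mono powr_mono2) auto
  finally show ?thesis .
qed

lemma ennreal_less_divide_iff:
  fixes a b t :: ennreal
  assumes "b \<noteq> 0" "b < \<infinity>"
  shows "t < a / b \<longleftrightarrow> t * b < a"
proof -
  have "a / b \<le> t \<longleftrightarrow> a \<le> t * b"
  proof
    assume "a / b \<le> t"
    then have "a / b * b \<le> t * b"
      by (rule mult_right_mono) simp
    then show "a \<le> t * b"
      using assms by (simp add: ennreal_divide_times)
  next
    assume "a \<le> t * b"
    then show "a / b \<le> t"
      using assms
      by (intro divide_le_posI_ennreal) (auto simp: mult.commute zero_less_iff_neq_zero)
  qed
  then show ?thesis
    by (simp flip: not_le)
qed

text \<open>If \<open>\<zeta> S = 0\<close>, the quotient is infinite and the left side holds;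
  membership in \<open>F_family\<close> then forces \<open>\<mu> S\<close> to be nonzero, so the
  right side holds as well.\<close>

lemma less_Q_quot_iff:
  assumes "S \<in> F_family \<mu> \<zeta>" "\<zeta> S < \<infinity>" "t < \<infinity>"
  shows "t < Q_quot \<mu> \<zeta> S \<longleftrightarrow> t * \<zeta> S < \<mu> S"
proof (cases "\<zeta> S = 0")
  case True
  then show ?thesis
    using assms by (auto simp: Q_quot_def F_family_def zero_less_iff_neq_zero)
next
  case False
  then have "t < \<mu> S / \<zeta> S \<longleftrightarrow> t * \<zeta> S < \<mu> S"
    using assms by (intro ennreal_less_divide_iff)
  with False assms show ?thesis by (simp add: Q_quot_def)
qed

text \<open>Finite \<open>t\<close> suffice, because nothing exceeds \<infinity> and that superlevel
  set is empty.\<close>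

lemma borel_measurable_lower_semicontinuous:
  fixes f :: "'a::topological_space \<Rightarrow> ennreal"
  assumes "\<And>t. t < \<infinity> \<Longrightarrow> open {x. t < f x}"
  shows "f \<in> borel_measurable borel"
proof (rule borel_measurableI_greater)
  fix t :: ennreal
  show "{x \<in> space borel. t < f x} \<in> sets borel"
    using assms[of t] by (cases "t = \<infinity>") (auto simp: less_top)
qed

definition density_at_scale ::
  "real \<Rightarrow> real \<Rightarrow> ('a::metric_space set \<Rightarrow> ennreal) \<Rightarrow> real \<Rightarrow> 'a \<Rightarrow> ennreal" where
  "density_at_scale c \<alpha> \<mu> \<epsilon> x =
     (SUP S\<in>{S \<in> F_family \<mu> (zeta c \<alpha>). x \<in> S \<and> ediam S < ennreal \<epsilon>}. Q_quot \<mu> (zeta c \<alpha>) S)"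

lemma density_at_scale_mono:
  "\<delta> \<le> \<epsilon> \<Longrightarrow> density_at_scale c \<alpha> \<mu> \<delta> x \<le> density_at_scale c \<alpha> \<mu> \<epsilon> x"
  unfolding density_at_scale_def
  by (intro SUP_subset_mono) (auto intro: less_le_trans ennreal_leI)

text \<open>By monotonicity in the scale, a sequence of scales tending to 0 gives the same infimum;
  measurability passes to countable infima only.\<close>

lemma federer_density_eq_INF_nat:
  "federer_density c \<alpha> \<mu> x = (INF n. density_at_scale c \<alpha> \<mu> (1 / Suc n) x)"
proof (rule antisym)
  show "federer_density c \<alpha> \<mu> x \<le> (INF n. density_at_scale c \<alpha> \<mu> (1 / Suc n) x)"
    unfolding federer_density_def density_at_scale_def[symmetric]
    by (intro INF_greatest INF_lower) simp
  show "(INF n. density_at_scale c \<alpha> \<mu> (1 / Suc n) x) \<le> federer_density c \<alpha> \<mu> x"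
    unfolding federer_density_def density_at_scale_def[symmetric]
  proof (rule INF_greatest)
    fix \<epsilon> :: real
    assume "\<epsilon> \<in> {0<..}"
    then obtain n where "1 / Suc n < \<epsilon>"
      using nat_approx_posE[of \<epsilon>] by auto
    then show "(INF n. density_at_scale c \<alpha> \<mu> (1 / Suc n) x) \<le> density_at_scale c \<alpha> \<mu> \<epsilon> x"
      by (intro INF_lower2[of n] density_at_scale_mono) auto
  qed
qed

lemma open_less_density_at_scale:
  fixes \<mu> :: "'a::metric_space set \<Rightarrow> ennreal"
  assumes mono: "\<And>S T. S \<subseteq> T \<Longrightarrow> \<mu> S \<le> \<mu> T"
    and c: "0 \<le> c" and \<alpha>: "0 < \<alpha>" and t: "t < \<infinity>"
  shows "open {x. t < density_at_scale c \<alpha> \<mu> \<epsilon> x}"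
  unfolding open_contains_ball
proof
  fix x
  assume "x \<in> {x. t < density_at_scale c \<alpha> \<mu> \<epsilon> x}"
  then obtain S where S: "S \<in> F_family \<mu> (zeta c \<alpha>)" "x \<in> S" "ediam S < ennreal \<epsilon>"
      and Q: "t < Q_quot \<mu> (zeta c \<alpha>) S"
    by (auto simp: density_at_scale_def less_SUP_iff)
  \<comment> \<open>The scale bound makes the diameter a real number, so
    \<open>zeta c \<alpha> S\<close> is finite and the branch of \<open>Q_quot\<close> for infinite
    \<zeta> does not arise.\<close>
  obtain d where d: "0 \<le> d" "ediam S = ennreal d" "d < \<epsilon>"
    using S by (cases "ediam S") (auto simp: ennreal_less_iff)
  have zS: "zeta c \<alpha> S = ennreal (c * d powr \<alpha>)"
    using d c by (simp add: zeta_def ennpowr_def ennreal_mult)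
  \<comment> \<open>Here \<open>d = 0\<close> is possible. Continuity of \<open>powr\<close> at base
    0 rests on \<open>0 < \<alpha>\<close> and on the bases being nonnegative for \<delta> > 0,
    whence the one-sided limit.\<close>
  have "((\<lambda>\<delta>. t * ennreal (c * (d + 2 * \<delta>) powr \<alpha>)) \<longlongrightarrow>
      t * ennreal (c * (d + 2 * 0) powr \<alpha>)) (at_right 0)"
    using t \<alpha> d
    by (intro ennreal_tendsto_cmult tendsto_ennrealI tendsto_intros tendsto_powr')
       (auto simp: eventually_at_filter)
  moreover have "t * ennreal (c * (d + 2 * 0) powr \<alpha>) < \<mu> S"
    using Q S t by (simp add: less_Q_quot_iff zS)
  ultimately have "\<forall>\<^sub>F \<delta> in at_right 0. t * ennreal (c * (d + 2 * \<delta>) powr \<alpha>) < \<mu> S"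
    by (rule order_tendstoD(2))
  moreover have "((\<lambda>\<delta>. d + 2 * \<delta>) \<longlongrightarrow> d + 2 * 0) (at_right 0)"
    by (intro tendsto_intros)
  then have "\<forall>\<^sub>F \<delta> in at_right 0. d + 2 * \<delta> < \<epsilon>"
    using d by (intro order_tendstoD(2)) auto
  moreover have "\<forall>\<^sub>F \<delta>::real in at_right 0. 0 < \<delta>"
    by (rule eventually_at_right_less)
  ultimately have "\<forall>\<^sub>F \<delta> in at_right 0.
      t * ennreal (c * (d + 2 * \<delta>) powr \<alpha>) < \<mu> S \<and> d + 2 * \<delta> < \<epsilon> \<and> 0 < \<delta>"
    by eventually_elim simp
  then obtain \<delta> where \<delta>: "t * ennreal (c * (d + 2 * \<delta>) powr \<alpha>) < \<mu> S" "d + 2 * \<delta> < \<epsilon>" "0 < \<delta>"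
    using eventually_happens[of _ "at_right (0::real)"] by auto
  define T where "T = S \<union> cball x \<delta>"
  have diamT: "ediam T \<le> ennreal (d + 2 * \<delta>)"
    unfolding T_def using S d \<delta> by (intro ediam_Un_cball_le) auto
  also have "\<dots> < ennreal \<epsilon>"
    using d \<delta> by (intro ennreal_lessI) auto
  finally have diamT': "ediam T < ennreal \<epsilon>" .
  have zT: "zeta c \<alpha> T \<le> ennreal (c * (d + 2 * \<delta>) powr \<alpha>)"
    using c \<alpha> d \<delta> diamT by (intro zeta_le) auto
  have zT_fin: "zeta c \<alpha> T < \<infinity>"
    using le_less_trans[OF zT ennreal_less_top] by simp
  have "t * zeta c \<alpha> T \<le> t * ennreal (c * (d + 2 * \<delta>) powr \<alpha>)"
    using zT by (intro mult_left_mono) auto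
  also note \<delta>(1)
  also have "\<mu> S \<le> \<mu> T"
    by (rule mono) (auto simp: T_def)
  finally have tT: "t * zeta c \<alpha> T < \<mu> T" .
  have "closed T"
    using S by (auto simp: T_def F_family_def)
  \<comment> \<open>The strict inequality \<open>tT\<close> gives \<open>\<mu> T\<close> > 0 and
    \<open>zT_fin\<close> excludes infinite \<zeta>, so neither excluded case applies to
    \<open>T\<close>.\<close>
  then have T: "T \<in> F_family \<mu> (zeta c \<alpha>)"
    using tT zT_fin by (auto simp: F_family_def)
  \<comment> \<open>The single set \<open>T\<close> is a competitor in the supremum at every point
    of the ball.\<close>
  have "t < density_at_scale c \<alpha> \<mu> \<epsilon> y" if "y \<in> ball x \<delta>" for y
  proof -
    have "y \<in> T" using that by (auto simp: T_def)
    moreover have "t < Q_quot \<mu> (zeta c \<alpha>) T"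
      using less_Q_quot_iff[OF T zT_fin t] tT by simp
    ultimately show ?thesis
      unfolding density_at_scale_def less_SUP_iff using T diamT' by blast
  qed
  then show "\<exists>e>0. ball x e \<subseteq> {x. t < density_at_scale c \<alpha> \<mu> \<epsilon> x}"
    using \<delta> by blast
qed

theorem theorem5p1:
  fixes \<mu> :: "'a::metric_space set \<Rightarrow> ennreal"
    and c \<alpha> :: real
    and A :: "'a set"
  assumes "outer_measure_space (Pow UNIV) \<mu>"
    and "c > 0"
    and "\<alpha> > 0"
    and "covers_finely (F_family \<mu> (zeta c \<alpha>)) A"
  shows "federer_density c \<alpha> \<mu> \<in> borel_measurable (restrict_space borel A)"
\<comment> \<open>The density is Borel on the whole space; where no admissible set is small enough,
  the supremum is over the empty set and equals 0.\<close>
proof (rule measurable_restrict_space1)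
  have "\<mu> S \<le> \<mu> T" if "S \<subseteq> T" for S T
    using assms(1) that by (auto simp: outer_measure_space_def increasing_def)
  then have "density_at_scale c \<alpha> \<mu> \<epsilon> \<in> borel_measurable borel" for \<epsilon>
    using assms by (intro borel_measurable_lower_semicontinuous open_less_density_at_scale) auto
  then have "(\<lambda>x. INF n. density_at_scale c \<alpha> \<mu> (1 / Suc n) x) \<in> borel_measurable borel"
    by (intro borel_measurable_INF) auto
  then show "federer_density c \<alpha> \<mu> \<in> borel_measurable borel"
    by (simp add: federer_density_eq_INF_nat[abs_def])
qed

end
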